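(* Let $\mathbf{A}$ be a normal distributive nearlattice. If every dense $\alpha$-filter of $A$ contains a dense element, then $\mathbf{A}$ is quasicomplemented.
   Context: A distributive nearlattice is a join-semilattice $\langle A,\vee,1\rangle$ with greatest element $1$ in which every principal filter $[a)=\{x\in A\colon a\le x\}$ is a bounded distributive lattice. A filter of $A$ is a subset containing $1$, upward closed, and closed under those binary meets that exist. For $a\in A$, $a^{\top}=\{x\in A\colon x\vee a=1\}$ and $a^{\top\top}=\{y\in A\colon y\vee x=1\text{ for all }x\in a^{\top}\}$; for a filter $F$, $F^{\top}=\{x\in A\colon x\vee f=1\text{ for all }f\in F\}$. An element $a$ is dense if $a^{\top}=\{1\}$; a filter $F$ is dense if $F^{\top}=\{1\}$. A filter $F$ is an $\alpha$-filter if $a^{\top\top}\subseteq F$ for all $a\in F$. A prime ideal is a non-empty proper downward closed, $\vee$-closed subset $P$ with $a\wedge b\in P\Rightarrow a\in P$ or $b\in P$ whenever $a\wedge b$ exists; a maximal ideal is a non-empty proper downward closed $\vee$-closed subset not properly contained in any other proper such subset. $\mathbf{A}$ is normal if each prime ideal is contained in a unique maximal ideal; $\mathbf{A}$ is quasicomplemented if for each $a\in A$ there exists $b\in A$ with $a^{\top\top}=b^{\top}$. *)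

theory Defs
  imports Main
begin

context order
begin

definition is_meet_in :: "'a set \<Rightarrow> 'a \<Rightarrow> 'a \<Rightarrow> 'a \<Rightarrow> bool" where
  "is_meet_in S x y m \<longleftrightarrow>
     m \<in> S \<and> m \<le> x \<and> m \<le> y \<and> (\<forall>z\<in>S. z \<le> x \<longrightarrow> z \<le> y \<longrightarrow> z \<le> m)"

definition is_join_in :: "'a set \<Rightarrow> 'a \<Rightarrow> 'a \<Rightarrow> 'a \<Rightarrow> bool" where
  "is_join_in S x y j \<longleftrightarrow>
     j \<in> S \<and> x \<le> j \<and> y \<le> j \<and> (\<forall>z\<in>S. x \<le> z \<longrightarrow> y \<le> z \<longrightarrow> j \<le> z)"

text \<open>The set \<open>S\<close> with the induced order is a bounded distributive lattice; the last conjunct is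
  \<open>x \<sqinter> (y \<squnion> z) = (x \<sqinter> y) \<squnion> (x \<sqinter> z)\<close>, with all meets and joins taken in \<open>S\<close>.\<close>

definition bounded_distributive_lattice_on :: "'a set \<Rightarrow> bool" where
  "bounded_distributive_lattice_on S \<longleftrightarrow>
     (\<exists>l\<in>S. \<forall>x\<in>S. l \<le> x) \<and>
     (\<exists>u\<in>S. \<forall>x\<in>S. x \<le> u) \<and>
     (\<forall>x\<in>S. \<forall>y\<in>S. (\<exists>m. is_meet_in S x y m) \<and> (\<exists>j. is_join_in S x y j)) \<and>
     (\<forall>x\<in>S. \<forall>y\<in>S. \<forall>z\<in>S. \<forall>j m p q.
        is_join_in S y z j \<longrightarrow> is_meet_in S x j m \<longrightarrow>
        is_meet_in S x y p \<longrightarrow> is_meet_in S x z q \<longrightarrow> is_join_in S p q m)"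

end

class distributive_nearlattice = semilattice_sup + order_top +
  assumes principal_filter_lattice: "bounded_distributive_lattice_on {x. a \<le> x}"

context distributive_nearlattice
begin

definition nl_filter :: "'a set \<Rightarrow> bool" where
  "nl_filter F \<longleftrightarrow>
     top \<in> F \<and>
     (\<forall>x\<in>F. \<forall>y. x \<le> y \<longrightarrow> y \<in> F) \<and>
     (\<forall>x\<in>F. \<forall>y\<in>F. \<forall>m. is_meet_in UNIV x y m \<longrightarrow> m \<in> F)"

text \<open>\<open>ann a\<close> is \<open>a\<^sup>\<top>\<close>, \<open>set_ann F\<close> is \<open>F\<^sup>\<top>\<close> and \<open>dann a\<close> is \<open>a\<^sup>\<top>\<^sup>\<top>\<close>.\<close>

definition ann :: "'a \<Rightarrow> 'a set" where
  "ann a = {x. sup x a = top}"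

definition set_ann :: "'a set \<Rightarrow> 'a set" where
  "set_ann F = {x. \<forall>f\<in>F. sup x f = top}"

definition dann :: "'a \<Rightarrow> 'a set" where
  "dann a = set_ann (ann a)"

definition dense_element :: "'a \<Rightarrow> bool" where
  "dense_element a \<longleftrightarrow> ann a = {top}"

definition dense_filter :: "'a set \<Rightarrow> bool" where
  "dense_filter F \<longleftrightarrow> nl_filter F \<and> set_ann F = {top}"

definition alpha_filter :: "'a set \<Rightarrow> bool" where
  "alpha_filter F \<longleftrightarrow> nl_filter F \<and> (\<forall>a\<in>F. dann a \<subseteq> F)"

definition proper_ideal :: "'a set \<Rightarrow> bool" where
  "proper_ideal I \<longleftrightarrow>
     I \<noteq> {} \<and> I \<noteq> UNIV \<and>
     (\<forall>x\<in>I. \<forall>y. y \<le> x \<longrightarrow> y \<in> I) \<and>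
     (\<forall>x\<in>I. \<forall>y\<in>I. sup x y \<in> I)"

definition prime_ideal :: "'a set \<Rightarrow> bool" where
  "prime_ideal P \<longleftrightarrow>
     proper_ideal P \<and>
     (\<forall>a b m. is_meet_in UNIV a b m \<longrightarrow> m \<in> P \<longrightarrow> a \<in> P \<or> b \<in> P)"

definition maximal_ideal :: "'a set \<Rightarrow> bool" where
  "maximal_ideal M \<longleftrightarrow> proper_ideal M \<and> \<not> (\<exists>I. proper_ideal I \<and> M \<subset> I)"

end

definition normal :: "'a::distributive_nearlattice itself \<Rightarrow> bool" where
  "normal (_ :: 'a itself) \<longleftrightarrow>
     (\<forall>P :: 'a set. prime_ideal P \<longrightarrow> (\<exists>!M. maximal_ideal M \<and> P \<subseteq> M))"

definition quasicomplemented :: "'a::distributive_nearlattice itself \<Rightarrow> bool" where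
  "quasicomplemented (_ :: 'a itself) \<longleftrightarrow> (\<forall>a :: 'a. \<exists>b. dann a = ann b)"

end

theory Submission
  imports Defs
begin

text \<open>
  Normality yields, for \<open>a \<squnion> b = 1\<close>, that every element is a meet of an element of \<open>a\<^sup>\<top>\<close> and one
  of \<open>b\<^sup>\<top>\<close>: an element \<open>c\<close> outside the filter \<open>a\<^sup>\<top> \<or> b\<^sup>\<top>\<close> lies in a prime ideal disjoint from
  that filter, and this prime ideal extends to one maximal ideal containing \<open>a\<close> and to another
  containing \<open>b\<close>.  Given \<open>a\<close>, this decomposition shows that the dense filter \<open>a\<^sup>\<top> \<or> a\<^sup>\<top>\<^sup>\<top>\<close> is an
  \<open>\<alpha>\<close>-filter.  If \<open>x \<sqinter> y\<close> is a dense element of it, with \<open>x \<in> a\<^sup>\<top>\<close> and \<open>y \<in> a\<^sup>\<top>\<^sup>\<top>\<close>, then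
  \<open>a\<^sup>\<top>\<^sup>\<top> = x\<^sup>\<top>\<close>.
\<close>

context distributive_nearlattice
begin

section \<open>Meets with a common lower bound, and distributivity\<close>

lemma nl_sup_top [simp]: "sup top x = top" "sup x top = top"
  by (simp_all add: sup_absorb1 sup_absorb2)

lemma is_join_in_principal_filter:
  assumes "m \<le> x" and "m \<le> y"
  shows "is_join_in {z. m \<le> z} x y (sup x y)"
  using assms by (auto simp: is_join_in_def intro: le_supI1)

text \<open>A lower bound \<open>z\<close> of \<open>x\<close> and \<open>y\<close> outside the
  principal filter can be replaced by \<open>sup z m\<close>, which is again a lower bound and lies
  in the filter.\<close>

lemma is_meet_in_principal_filter_iff:
  assumes "m \<le> x" and "m \<le> y"
  shows "is_meet_in {z. m \<le> z} x y n \<longleftrightarrow> is_meet_in UNIV x y n"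
proof
  assume n: "is_meet_in {z. m \<le> z} x y n"
  have "z \<le> n" if "z \<le> x" "z \<le> y" for z
  proof -
    have "sup z m \<le> x" "sup z m \<le> y" using that assms by simp_all
    then have "sup z m \<le> n"
      using n sup_ge2[of m z] unfolding is_meet_in_def by blast
    then show ?thesis by simp
  qed
  with n show "is_meet_in UNIV x y n"
    by (auto simp: is_meet_in_def)
qed (use assms in \<open>auto simp: is_meet_in_def\<close>)

lemma ex_meet:
  assumes "m \<le> x" and "m \<le> y"
  shows "\<exists>n. is_meet_in UNIV x y n"
proof -
  have "\<exists>n. is_meet_in {z. m \<le> z} x y n"
    using principal_filter_lattice[of m] assms
    unfolding bounded_distributive_lattice_on_def by simp
  then show ?thesis
    by (simp only: is_meet_in_principal_filter_iff[OF assms])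
qed

text \<open>This is the distributive law of the principal filter of \<open>m\<close> in the case
  \<open>x \<le> sup y z\<close>, where the meet of \<open>x\<close> with \<open>sup y z\<close> is
  \<open>x\<close>. It is freed from relative meets and joins.\<close>

lemma sup_meets_eq:
  assumes "m \<le> x" "m \<le> y" "m \<le> z" and "x \<le> sup y z"
    and p: "is_meet_in UNIV x y p" and q: "is_meet_in UNIV x z q"
  shows "sup p q = x"
proof -
  have pq: "is_meet_in {z. m \<le> z} x y p" "is_meet_in {z. m \<le> z} x z q"
    using p q assms by (simp_all add: is_meet_in_principal_filter_iff)
  have x: "is_meet_in {z. m \<le> z} x (sup y z) x"
    using assms by (auto simp: is_meet_in_def)
  have "is_join_in {z. m \<le> z} p q x"
    by (rule principal_filter_lattice[of m, unfolded bounded_distributive_lattice_on_def,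
          THEN conjunct2, THEN conjunct2, THEN conjunct2, rule_format,
          OF _ _ _ is_join_in_principal_filter x pq]) (use assms in simp_all)
  moreover have "is_join_in {z. m \<le> z} p q (sup p q)"
    using pq by (intro is_join_in_principal_filter) (auto simp: is_meet_in_def)
  ultimately show ?thesis
    unfolding is_join_in_def by (metis order.antisym)
qed

text \<open>The dual distributive law. As \<open>k\<close> need not share a lower bound with
  \<open>a\<close> and \<open>b\<close>, it is first replaced by \<open>K\<close>, which lies above
  \<open>m\<close>; this changes neither \<open>sup k a\<close> nor \<open>sup k b\<close>.\<close>

lemma sup_meet_distrib:
  assumes m: "is_meet_in UNIV a b m"
  shows "is_meet_in UNIV (sup k a) (sup k b) (sup k m)"
proof -
  have le: "m \<le> a" "m \<le> b" using m by (auto simp: is_meet_in_def)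
  define K where "K = sup k m"
  have K: "m \<le> K" "sup K a = sup k a" "sup K b = sup k b"
    using le by (auto simp: K_def sup_assoc sup_absorb2)
  have "z \<le> K" if "z \<le> sup k a" "z \<le> sup k b" for z
  proof -
    \<comment> \<open>Since \<open>n\<close> lies above \<open>m\<close>, the meets below exist.
      Distributivity splits \<open>n\<close> into its meets with \<open>K\<close> and
      \<open>a\<close>, and then the second part \<open>q\<close> into its meets with
      \<open>K\<close> and \<open>b\<close>. The last piece \<open>s\<close> is below
      \<open>a\<close> and \<open>b\<close>, hence below \<open>m \<le> K\<close>.\<close>
    define n where "n = sup z m"
    have n: "m \<le> n" "n \<le> sup K a" "n \<le> sup K b"
      using that le K by (auto simp: n_def le_supI2)
    obtain p where p: "is_meet_in UNIV n K p" using ex_meet n(1) K(1) by blast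
    obtain q where q: "is_meet_in UNIV n a q" using ex_meet n(1) le(1) by blast
    have mq: "m \<le> q" "q \<le> n" "q \<le> a" using q n le by (auto simp: is_meet_in_def)
    obtain r where r: "is_meet_in UNIV q K r" using ex_meet mq(1) K(1) by blast
    obtain s where s: "is_meet_in UNIV q b s" using ex_meet mq(1) le(2) by blast
    have "s \<le> m" using m s mq unfolding is_meet_in_def by (meson UNIV_I order_trans)
    moreover have "r \<le> K" using r by (simp add: is_meet_in_def)
    moreover have "sup r s = q"
      using sup_meets_eq[OF mq(1) K(1) le(2) _ r s] mq n order_trans by blast
    ultimately have "q \<le> K" using K(1) by (metis le_sup_iff order_trans order_refl)
    moreover have "p \<le> K" using p by (simp add: is_meet_in_def)
    moreover have "sup p q = n"
      using sup_meets_eq[OF n(1) K(1) le(1) n(2) p q] .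
    ultimately have "n \<le> K" using le_supI by blast
    then show ?thesis by (simp add: n_def)
  qed
  then show ?thesis
    using le by (auto simp: is_meet_in_def K_def le_supI2)
qed

lemma sup_meet_eq_top:
  assumes "is_meet_in UNIV a b m" and "sup k a = top" and "sup k b = top"
  shows "sup k m = top"
proof -
  have "top \<le> sup k m"
    using sup_meet_distrib[OF assms(1), of k] assms(2,3) by (simp add: is_meet_in_def)
  then show ?thesis by (simp add: top_unique)
qed

section \<open>Annihilator filters and joins of two filters\<close>

lemma nl_filter_set_ann: "nl_filter (set_ann S)"
  unfolding nl_filter_def
proof (intro conjI ballI allI impI)
  fix x y assume x: "x \<in> set_ann S" and le: "x \<le> y"
  have "sup y f = top" if "f \<in> S" for f
    using x that sup_mono[OF le order_refl[of f]] by (simp add: set_ann_def top_unique)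
  then show "y \<in> set_ann S" by (simp add: set_ann_def)
next
  fix x y m assume "x \<in> set_ann S" "y \<in> set_ann S" "is_meet_in UNIV x y m"
  then show "m \<in> set_ann S"
    using sup_meet_eq_top[of x y m] by (simp add: set_ann_def) (metis sup_commute)
qed (simp add: set_ann_def)

lemma ann_eq_set_ann: "ann a = set_ann {a}"
  by (simp add: ann_def set_ann_def)

lemma nl_filter_ann: "nl_filter (ann a)"
  by (simp add: ann_eq_set_ann nl_filter_set_ann)

lemma nl_filter_dann: "nl_filter (dann a)"
  by (simp add: dann_def nl_filter_set_ann)

text \<open>For filters this is their join in the lattice of filters: no upward closure has to be
  added, because distributivity supplies it.\<close>

definition filter_join :: "'a set \<Rightarrow> 'a set \<Rightarrow> 'a set" where
  "filter_join F G = {c. \<exists>x\<in>F. \<exists>y\<in>G. is_meet_in UNIV x y c}"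

lemma subset_filter_join:
  assumes "nl_filter F" and "nl_filter G"
  shows "F \<subseteq> filter_join F G" and "G \<subseteq> filter_join F G"
proof -
  have top: "is_meet_in UNIV x top x" "is_meet_in UNIV top x x" for x
    by (auto simp: is_meet_in_def)
  show "F \<subseteq> filter_join F G" "G \<subseteq> filter_join F G"
    using assms top unfolding filter_join_def nl_filter_def by blast+
qed

lemma nl_filter_filter_join:
  assumes F: "nl_filter F" and G: "nl_filter G"
  shows "nl_filter (filter_join F G)"
  unfolding nl_filter_def
proof (intro conjI ballI allI impI)
  show "top \<in> filter_join F G"
    using subset_filter_join(1)[OF F G] F by (auto simp: nl_filter_def)
next
  fix c d assume "c \<in> filter_join F G" "c \<le> d"
  then obtain x y where xy: "x \<in> F" "y \<in> G" "is_meet_in UNIV x y c"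
    by (auto simp: filter_join_def)
  \<comment> \<open>An element \<open>d\<close> above the meet of \<open>x\<close> and
    \<open>y\<close> is itself a meet, of \<open>sup d x\<close> and \<open>sup d y\<close>.\<close>
  have "is_meet_in UNIV (sup d x) (sup d y) d"
    using sup_meet_distrib[OF xy(3), of d] \<open>c \<le> d\<close> by (simp add: sup_absorb1)
  moreover have "sup d x \<in> F" "sup d y \<in> G"
    using F G xy sup_ge2 unfolding nl_filter_def by blast+
  ultimately show "d \<in> filter_join F G"
    by (auto simp: filter_join_def)
next
  fix c d m
  assume "c \<in> filter_join F G" "d \<in> filter_join F G" and m: "is_meet_in UNIV c d m"
  then obtain x y x' y' where xy: "x \<in> F" "y \<in> G" "is_meet_in UNIV x y c"
      and xy': "x' \<in> F" "y' \<in> G" "is_meet_in UNIV x' y' d"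
    by (auto simp: filter_join_def)
  have le: "m \<le> x" "m \<le> y" "m \<le> x'" "m \<le> y'"
    using xy(3) xy'(3) m by (auto simp: is_meet_in_def intro: order_trans)
  obtain u where u: "is_meet_in UNIV x x' u" using ex_meet le by blast
  obtain v where v: "is_meet_in UNIV y y' v" using ex_meet le by blast
  have "u \<in> F" "v \<in> G"
    using F G xy(1,2) xy'(1,2) u v unfolding nl_filter_def by blast+
  moreover have "is_meet_in UNIV u v m"
    using u v m xy(3) xy'(3) le unfolding is_meet_in_def
    by (meson UNIV_I order_trans)
  ultimately show "m \<in> filter_join F G" by (auto simp: filter_join_def)
qed

section \<open>Maximal and prime ideals\<close>

lemma proper_ideal_iff:
  "proper_ideal I \<longleftrightarrow> I \<noteq> {} \<and> top \<notin> I \<and>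
     (\<forall>x\<in>I. \<forall>y. y \<le> x \<longrightarrow> y \<in> I) \<and> (\<forall>x\<in>I. \<forall>y\<in>I. sup x y \<in> I)"
  unfolding proper_ideal_def using top_greatest by blast

text \<open>Zorn's lemma, with \<open>G\<close> an arbitrary set: the empty set gives maximal
  ideals, a filter gives prime ideals.\<close>

lemma ex_maximal_disjoint_ideal:
  assumes I: "proper_ideal I" "I \<inter> G = {}"
  shows "\<exists>M. proper_ideal M \<and> M \<inter> G = {} \<and> I \<subseteq> M \<and>
    (\<forall>J. proper_ideal J \<longrightarrow> J \<inter> G = {} \<longrightarrow> M \<subseteq> J \<longrightarrow> J = M)"
proof -
  let ?A = "{J. proper_ideal J \<and> J \<inter> G = {} \<and> I \<subseteq> J}"
  have "\<Union>C \<in> ?A" if "C \<noteq> {}" and C: "subset.chain ?A C" for C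
  proof -
    have J: "proper_ideal J" "J \<inter> G = {}" "I \<subseteq> J" if "J \<in> C" for J
      using C that by (auto simp: subset_chain_def)
    have sup: "sup x y \<in> \<Union>C" if "x \<in> \<Union>C" "y \<in> \<Union>C" for x y
    proof -
      from that obtain J K where JK: "J \<in> C" "K \<in> C" "x \<in> J" "y \<in> K" by blast
      have "J \<subseteq> K \<or> K \<subseteq> J" using C JK(1,2) by (auto simp: subset_chain_def)
      then obtain L where L: "L \<in> C" "x \<in> L" "y \<in> L" using JK by blast
      with J(1)[OF L(1)] show ?thesis unfolding proper_ideal_def by blast
    qed
    have "I \<subseteq> \<Union>C" using \<open>C \<noteq> {}\<close> J(3) by blast
    moreover have "\<Union>C \<inter> G = {}" using J(2) by blast
    moreover have "proper_ideal (\<Union>C)"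
      unfolding proper_ideal_iff
    proof (intro conjI ballI allI impI)
      show "\<Union>C \<noteq> {}" using \<open>I \<subseteq> \<Union>C\<close> I(1) unfolding proper_ideal_def by blast
      show "top \<notin> \<Union>C" using J(1) unfolding proper_ideal_iff by blast
      show "y \<in> \<Union>C" if "x \<in> \<Union>C" "y \<le> x" for x y
        using that J(1) unfolding proper_ideal_def by blast
    qed (fact sup)
    ultimately show ?thesis by blast
  qed
  moreover have "?A \<noteq> {}" using I by blast
  ultimately have "\<exists>M\<in>?A. \<forall>J\<in>?A. M \<subseteq> J \<longrightarrow> J = M"
    by (intro subset_Zorn_nonempty)
  then obtain M where M: "M \<in> ?A" and max: "\<And>J. J \<in> ?A \<Longrightarrow> M \<subseteq> J \<Longrightarrow> J = M"
    by (elim bexE) (rule that, assumption, blast)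
  have "J = M" if "proper_ideal J" "J \<inter> G = {}" "M \<subseteq> J" for J
    using M that by (intro max) auto
  moreover have "proper_ideal M" "M \<inter> G = {}" "I \<subseteq> M" using M by simp_all
  ultimately show ?thesis by (intro exI[of _ M] conjI allI impI)
qed

lemma ex_maximal_ideal:
  assumes "proper_ideal I"
  shows "\<exists>M. maximal_ideal M \<and> I \<subseteq> M"
  using ex_maximal_disjoint_ideal[of I "{}"] assms
  unfolding maximal_ideal_def by (metis inf_bot_right psubset_eq)

text \<open>For an ideal \<open>I\<close>, this is the ideal generated by \<open>I\<close> and
  \<open>a\<close>, possibly improper.\<close>

definition adjoin :: "'a set \<Rightarrow> 'a \<Rightarrow> 'a set" where
  "adjoin I a = {z. \<exists>i\<in>I. z \<le> sup i a}"

lemma subset_adjoin: "I \<subseteq> adjoin I a"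
  by (auto simp: adjoin_def intro: sup_ge1)

lemma mem_adjoin: "I \<noteq> {} \<Longrightarrow> a \<in> adjoin I a"
  by (auto simp: adjoin_def)

lemma proper_ideal_adjoin:
  assumes "proper_ideal I" and "\<And>i. i \<in> I \<Longrightarrow> sup i a \<noteq> top"
  shows "proper_ideal (adjoin I a)"
proof -
  have "sup x y \<in> adjoin I a" if "x \<in> adjoin I a" "y \<in> adjoin I a" for x y
  proof -
    from that obtain i j where ij: "i \<in> I" "j \<in> I" "x \<le> sup i a" "y \<le> sup j a"
      by (auto simp: adjoin_def)
    have "sup x y \<le> sup (sup i a) (sup j a)" using ij sup_mono by blast
    also have "\<dots> = sup (sup i j) a" by (simp add: ac_simps)
    finally show ?thesis
      using ij assms(1) by (auto simp: adjoin_def proper_ideal_def)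
  qed
  moreover have "top \<notin> adjoin I a"
    using assms(2) by (auto simp: adjoin_def top_unique)
  moreover have "adjoin I a \<noteq> {}"
    using assms(1) mem_adjoin[of I a] unfolding proper_ideal_def by blast
  moreover have "\<forall>x\<in>adjoin I a. \<forall>y. y \<le> x \<longrightarrow> y \<in> adjoin I a"
    unfolding adjoin_def using order_trans by blast
  ultimately show ?thesis by (simp add: proper_ideal_iff)
qed

text \<open>Prime separation: an ideal maximal among the proper ideals that contain \<open>c\<close>
  and avoid \<open>G\<close> is prime.\<close>

lemma ex_prime_ideal:
  assumes G: "nl_filter G" and "c \<notin> G"
  shows "\<exists>P. prime_ideal P \<and> c \<in> P \<and> P \<inter> G = {}"
proof -
  have "c \<noteq> top" using assms unfolding nl_filter_def by blast
  then have "proper_ideal {z. z \<le> c}"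
    unfolding proper_ideal_iff using order_trans by (simp add: top_unique) blast
  moreover have "{z. z \<le> c} \<inter> G = {}"
    using assms unfolding nl_filter_def by blast
  ultimately obtain P where P: "proper_ideal P" "P \<inter> G = {}" "{z. z \<le> c} \<subseteq> P"
    and max: "\<And>J. proper_ideal J \<Longrightarrow> J \<inter> G = {} \<Longrightarrow> P \<subseteq> J \<Longrightarrow> J = P"
    using ex_maximal_disjoint_ideal by metis
  have up: "x \<in> G \<Longrightarrow> x \<le> y \<Longrightarrow> y \<in> G" for x y
    using G unfolding nl_filter_def by blast
  \<comment> \<open>Otherwise adjoining \<open>a\<close> would give a strictly larger ideal avoiding
    \<open>G\<close>; it is proper because \<open>top\<close> belongs to \<open>G\<close>.\<close>
  have meets: "\<exists>i\<in>P. sup i a \<in> G" if "a \<notin> P" for a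
  proof (rule ccontr)
    assume no: "\<not> ?thesis"
    have "top \<in> G" using G by (simp add: nl_filter_def)
    then have "proper_ideal (adjoin P a)"
      using no by (intro proper_ideal_adjoin P) metis
    moreover have "adjoin P a \<inter> G = {}"
      using no up by (auto simp: adjoin_def)
    ultimately have "adjoin P a = P" using max subset_adjoin by blast
    then show False using that mem_adjoin P(1) by (auto simp: proper_ideal_def)
  qed
  have "a \<in> P \<or> b \<in> P" if m: "is_meet_in UNIV a b m" "m \<in> P" for a b m
  proof (rule ccontr)
    assume "\<not> ?thesis"
    then obtain i j where ij: "i \<in> P" "sup i a \<in> G" "j \<in> P" "sup j b \<in> G"
      using meets by blast
    \<comment> \<open>One \<open>?k\<close> serves both \<open>a\<close> and \<open>b\<close>, so
      that distributivity puts \<open>sup ?k m\<close> into \<open>G\<close> as well as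
      \<open>P\<close>.\<close>
    let ?k = "sup i j"
    have "sup ?k a \<in> G" "sup ?k b \<in> G"
      using up[OF ij(2), of "sup ?k a"] up[OF ij(4), of "sup ?k b"]
      by (simp_all add: le_supI1)
    then have "sup ?k m \<in> G"
      using sup_meet_distrib[OF m(1)] G unfolding nl_filter_def by blast
    moreover have "sup ?k m \<in> P"
      using ij m(2) P(1) unfolding proper_ideal_def by blast
    ultimately show False using P(2) by blast
  qed
  then have "prime_ideal P" using P(1) unfolding prime_ideal_def by blast
  then show ?thesis using P(2,3) by blast
qed

section \<open>Normality, and the filter generated by \<open>ann a\<close> and
  \<open>dann a\<close>\<close>

lemma filter_join_ann_eq_UNIV:
  assumes normal: "\<And>P. prime_ideal P \<Longrightarrow> \<exists>!M. maximal_ideal M \<and> P \<subseteq> M"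
    and ab: "sup a b = top"
  shows "filter_join (ann a) (ann b) = UNIV"
proof (rule ccontr)
  let ?G = "filter_join (ann a) (ann b)"
  assume "?G \<noteq> UNIV"
  then obtain c where "c \<notin> ?G" by blast
  then obtain P where P: "prime_ideal P" "P \<inter> ?G = {}"
    using ex_prime_ideal nl_filter_filter_join nl_filter_ann by meson
  have P_proper: "proper_ideal P" using P(1) by (simp add: prime_ideal_def)
  \<comment> \<open>Adjoining \<open>x\<close> to \<open>P\<close> keeps it proper: if
    \<open>sup i x = top\<close> with \<open>i \<in> P\<close>, then \<open>i \<in> ann x\<close>,
    so \<open>P\<close> would meet \<open>?G\<close>.\<close>
  have ex: "\<exists>M. maximal_ideal M \<and> P \<subseteq> M \<and> x \<in> M" if "ann x \<subseteq> ?G" for x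
  proof -
    have "proper_ideal (adjoin P x)"
      using that P(2) by (intro proper_ideal_adjoin P_proper) (auto simp: ann_def)
    then obtain M where "maximal_ideal M" "adjoin P x \<subseteq> M"
      using ex_maximal_ideal by blast
    then show ?thesis
      using subset_adjoin mem_adjoin P_proper unfolding proper_ideal_def by blast
  qed
  obtain M N where MN: "maximal_ideal M" "P \<subseteq> M" "a \<in> M" "maximal_ideal N" "P \<subseteq> N" "b \<in> N"
    using ex subset_filter_join[OF nl_filter_ann nl_filter_ann] by meson
  then have "M = N" using normal[OF P(1)] by blast
  then have "top \<in> M"
    using MN ab unfolding maximal_ideal_def proper_ideal_def by metis
  then show False using MN(1) by (simp add: maximal_ideal_def proper_ideal_iff)
qed

text \<open>If \<open>x\<close> annihilates \<open>S\<close>, then \<open>S\<close> is contained in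
  \<open>ann x\<close>, so whatever annihilates \<open>ann x\<close> annihilates \<open>S\<close>.
  Both \<open>ann a\<close> and \<open>dann a\<close> have the form
  \<open>set_ann S\<close>.\<close>

lemma dann_subset:
  assumes "x \<in> set_ann S"
  shows "dann x \<subseteq> set_ann S"
  using assms by (auto simp: dann_def set_ann_def ann_def sup_commute)

text \<open>For \<open>w \<in> ann y\<close>, the element \<open>sup w p\<close> annihilates
  \<open>x\<close> through \<open>p\<close> and \<open>y\<close> through \<open>w\<close>, hence
  also their meet \<open>c\<close>; then \<open>p \<in> dann c\<close> applies to it.\<close>

lemma mem_dann_factor:
  assumes c: "is_meet_in UNIV x y c" and "p \<in> dann c" and "sup p x = top"
  shows "p \<in> dann y"
  unfolding dann_def set_ann_def
proof (intro CollectI ballI)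
  fix w assume "w \<in> ann y"
  then have "sup (sup w p) x = top" "sup (sup w p) y = top"
    using assms(3) by (simp_all add: ann_def sup_assoc sup_left_commute[of w p y])
  then have "sup (sup w p) c = top" by (rule sup_meet_eq_top[OF c])
  then have "sup p (sup w p) = top"
    using assms(2) by (simp add: dann_def set_ann_def ann_def)
  then show "sup p w = top" by (simp add: sup_commute)
qed

lemma alpha_filter_ann_dann:
  assumes normal: "\<And>P. prime_ideal P \<Longrightarrow> \<exists>!M. maximal_ideal M \<and> P \<subseteq> M"
  shows "alpha_filter (filter_join (ann a) (dann a))"
  unfolding alpha_filter_def
proof (intro conjI ballI subsetI)
  show "nl_filter (filter_join (ann a) (dann a))"
    by (intro nl_filter_filter_join nl_filter_ann nl_filter_dann)
next
  fix c z assume "c \<in> filter_join (ann a) (dann a)" and z: "z \<in> dann c"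
  then obtain x y where x: "x \<in> ann a" and y: "y \<in> dann a" and c: "is_meet_in UNIV x y c"
    by (auto simp: filter_join_def)
  have "sup x y = top"
    using x y by (auto simp: dann_def set_ann_def sup_commute)
  then have "z \<in> filter_join (ann x) (ann y)"
    using filter_join_ann_eq_UNIV[OF normal] by simp
  then obtain p q where p: "sup p x = top" and q: "sup q y = top" and pq: "is_meet_in UNIV p q z"
    by (auto simp: filter_join_def ann_def)
  \<comment> \<open>Both lie above \<open>z\<close>. The roles then cross: \<open>p\<close>
    annihilates \<open>x\<close> and so belongs to \<open>dann y\<close>, while \<open>q\<close>
    annihilates \<open>y\<close> and so belongs to \<open>dann x\<close>.\<close>
  have "p \<in> dann c" "q \<in> dann c"
    using pq z nl_filter_dann[of c] unfolding nl_filter_def is_meet_in_def by blast+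
  moreover have "is_meet_in UNIV y x c" using c by (auto simp: is_meet_in_def)
  ultimately have "p \<in> dann y" "q \<in> dann x"
    using mem_dann_factor p q c by blast+
  then have "p \<in> dann a" "q \<in> ann a"
    using dann_subset x y by (auto simp: dann_def ann_eq_set_ann)
  moreover have "is_meet_in UNIV q p z" using pq by (auto simp: is_meet_in_def)
  ultimately show "z \<in> filter_join (ann a) (dann a)"
    by (auto simp: filter_join_def)
qed

lemma dense_filter_ann_dann: "dense_filter (filter_join (ann a) (dann a))"
proof -
  let ?F = "filter_join (ann a) (dann a)"
  have "x = top" if "x \<in> set_ann ?F" for x
  proof -
    \<comment> \<open>Annihilating both parts, \<open>x\<close> lies in \<open>dann a\<close> and
      annihilates \<open>dann a\<close>, hence annihilates itself.\<close>
    have "x \<in> dann a" "x \<in> set_ann (dann a)"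
      using that subset_filter_join[OF nl_filter_ann[of a] nl_filter_dann[of a]]
      by (auto simp: dann_def set_ann_def)
    then have "sup x x = top" unfolding set_ann_def by blast
    then show ?thesis by simp
  qed
  moreover have "top \<in> set_ann ?F" by (simp add: set_ann_def)
  ultimately show ?thesis
    by (auto simp: dense_filter_def nl_filter_filter_join nl_filter_ann nl_filter_dann)
qed

lemma dann_eq_ann_of_dense_meet:
  assumes d: "is_meet_in UNIV x y d" "dense_element d"
    and x: "x \<in> ann a" and y: "y \<in> dann a"
  shows "dann a = ann x"
proof
  show "dann a \<subseteq> ann x" using x by (auto simp: dann_def set_ann_def ann_def)
next
  have "sup w v = top" if w: "w \<in> ann x" and v: "v \<in> ann a" for w v
  proof -
    \<comment> \<open>Thus \<open>sup w v\<close> annihilates \<open>x\<close> through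
      \<open>w\<close> and \<open>y\<close> through \<open>v\<close>, hence the dense element
      \<open>d\<close>, which forces it to be \<open>top\<close>.\<close>
    have "sup v y = top" using v y by (auto simp: dann_def set_ann_def sup_commute)
    then have "sup (sup w v) x = top" "sup (sup w v) y = top"
      using w by (simp_all add: ann_def sup_assoc sup_left_commute[of w v x])
    then have "sup (sup w v) d = top" by (rule sup_meet_eq_top[OF d(1)])
    then have "sup w v \<in> ann d" by (simp add: ann_def)
    then show ?thesis using d(2) by (simp add: dense_element_def)
  qed
  then show "ann x \<subseteq> dann a" by (auto simp: dann_def set_ann_def)
qed

end

theorem theorem3p12:
  assumes "normal TYPE('a::distributive_nearlattice)"
    and "\<And>F :: 'a set. dense_filter F \<Longrightarrow> alpha_filter F \<Longrightarrow> \<exists>d\<in>F. dense_element d"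
  shows "quasicomplemented TYPE('a)"
  unfolding quasicomplemented_def
proof
  fix a :: 'a
  have "alpha_filter (filter_join (ann a) (dann a))"
    using assms(1) by (intro alpha_filter_ann_dann) (simp add: normal_def)
  then obtain d where "d \<in> filter_join (ann a) (dann a)" "dense_element d"
    using assms(2) dense_filter_ann_dann by blast
  then show "\<exists>b. dann a = ann b"
    using dann_eq_ann_of_dense_meet unfolding filter_join_def by blast
qed

end
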